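(* Let $R$ be the ELT algebra with tangible values $F=(\mathbb{R},+)$ and layers $L=\mathbb{Q}$. Then every regular polynomial $f\in R[\lambda]$ in one variable factors uniquely into irreducible factors (up to order and multiplication of the factors by constants).
   Context: ELT algebra: $R=\{{}^{[\ell]}\lambda : \lambda\in F,\ \ell\in L\}$, here with $F=(\mathbb{R},+)$ (usual order) and $L=\mathbb{Q}$, with operations: ${}^{[\ell_1]}\lambda+{}^{[\ell_2]}\lambda={}^{[\ell_1+\ell_2]}\lambda$; ${}^{[\ell_1]}\lambda_1+{}^{[\ell_2]}\lambda_2={}^{[\ell_1]}\lambda_1$ if $\lambda_1>\lambda_2$ (and symmetrically); ${}^{[\ell_1]}\lambda_1\cdot{}^{[\ell_2]}\lambda_2={}^{[\ell_1\ell_2]}(\lambda_1+_F\lambda_2)$. The layer is $s({}^{[\ell]}\lambda)=\ell$. A polynomial in $R[\lambda_1,\dots,\lambda_n]$ is a function $R^n\to R$ of the form $\sum_{I\in G}a_I\lambda^I$ with $G\subseteq(\mathbb{N}\cup\{0\})^n$ finite and $a_I\in R$; two polynomials are equal iff they are equal as functions. A monomial $h$ of an expression $f=\sum_i h_i$ is inessential if deleting it does not change the value of $f$ at any point; inessential monomials are deleted, and "the monomials of $f$" are the remaining ones. $f$ is regular if every (non-deleted) monomial of $f$ has a coefficient of nonzero layer. A polynomial is irreducible if it is non-constant and is not a product of two non-constant polynomials. *)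

theory Defs
  imports Complex_Main "HOL-Library.Multiset" "HOL-Library.Function_Algebras"
begin

text \<open>The ELT algebra with layers in \<open>'l\<close> and tangible values in \<open>'f\<close>: \<open>ELT l t\<close> is the
  element of layer \<open>l\<close> over \<open>t\<close>. There is no element at minus infinity, hence no additive
  zero.\<close>

datatype ('l, 'f) elt = ELT (layer: 'l) (tang: 'f)

instantiation elt :: (comm_semiring_1, linordered_ab_group_add) "{comm_semiring, comm_monoid_mult}"
begin

definition plus_elt :: "('a, 'b) elt \<Rightarrow> ('a, 'b) elt \<Rightarrow> ('a, 'b) elt" where
  "x + y = (if tang y < tang x then x
            else if tang x < tang y then y
            else ELT (layer x + layer y) (tang x))"

definition times_elt :: "('a, 'b) elt \<Rightarrow> ('a, 'b) elt \<Rightarrow> ('a, 'b) elt" where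
  "x * y = ELT (layer x * layer y) (tang x + tang y)"

definition one_elt :: "('a, 'b) elt" where
  "1 = ELT 1 0"

instance
proof
  fix x y z :: "('a, 'b) elt"
  show "x + y + z = x + (y + z)"
    by (auto simp: plus_elt_def ac_simps)
  show "x + y = y + x"
    by (auto simp: plus_elt_def ac_simps intro: elt.expand)
  show "x * y * z = x * (y * z)" "x * y = y * x" "1 * x = x"
    by (auto simp: times_elt_def one_elt_def ac_simps)
  show "(x + y) * z = x * z + y * z"
    by (auto simp: plus_elt_def times_elt_def algebra_simps)
qed

end

text \<open>As there is no zero, \<^const>\<open>sum\<close> is not available. The sum over a finite nonempty index
  set starts from the term with the least index; nothing is meant by its value on an empty or
  infinite set.\<close>

definition elt_sum :: "(nat \<Rightarrow> 'a :: ab_semigroup_add) \<Rightarrow> nat set \<Rightarrow> 'a" where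
  "elt_sum h G = Finite_Set.fold (\<lambda>i s. h i + s) (h (Min G)) (G - {Min G})"

lemma elt_sum_singleton: "elt_sum h {i} = h i"
  by (simp add: elt_sum_def)

lemma elt_sum_insert:
  assumes "finite G" "G \<noteq> {}" "i \<notin> G"
  shows "elt_sum h (insert i G) = h i + elt_sum h G"
proof -
  interpret comp_fun_commute "\<lambda>i s. h i + s"
    by standard (simp add: fun_eq_iff add.left_commute)
  have swap: "h k + Finite_Set.fold (\<lambda>i s. h i + s) (h j) H
      = h j + Finite_Set.fold (\<lambda>i s. h i + s) (h k) H" if "finite H" for j k H
    using that
  proof induction
    case empty
    show ?case by (simp add: add.commute)
  next
    case (insert x H)
    have "h k + (h x + Finite_Set.fold (\<lambda>i s. h i + s) (h j) H)
        = h x + (h k + Finite_Set.fold (\<lambda>i s. h i + s) (h j) H)"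
      by (rule add.left_commute)
    also have "\<dots> = h x + (h j + Finite_Set.fold (\<lambda>i s. h i + s) (h k) H)"
      by (simp only: insert.IH)
    also have "\<dots> = h j + (h x + Finite_Set.fold (\<lambda>i s. h i + s) (h k) H)"
      by (rule add.left_commute)
    finally show ?case
      by (simp only: fold_insert[OF insert.hyps])
  qed
  show ?thesis
  proof (cases "i < Min G")
    case True
    define m where "m = Min G"
    have m: "m \<in> G" "finite (G - {m})" using assms by (auto simp: m_def)
    have "Min (insert i G) = i" using assms True by simp
    then have "elt_sum h (insert i G) = Finite_Set.fold (\<lambda>i s. h i + s) (h i) G"
      using assms(3) by (simp add: elt_sum_def)
    also have "\<dots> = h m + Finite_Set.fold (\<lambda>i s. h i + s) (h i) (G - {m})"
      using fold_rec[OF assms(1) m(1)] by simp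
    also have "\<dots> = h i + Finite_Set.fold (\<lambda>i s. h i + s) (h m) (G - {m})"
      by (rule swap[OF m(2)])
    finally show ?thesis by (simp add: elt_sum_def m_def)
  next
    case False
    define m where "m = Min G"
    have m: "m \<in> G" using assms by (auto simp: m_def)
    have "i \<noteq> m" using m assms(3) by blast
    have "m \<le> i" using False by (simp only: m_def not_less)
    then have "Min (insert i G) = m"
      unfolding m_def using Min_insert[OF assms(1,2), of i] by (simp only: min.absorb2)
    moreover have "insert i G - {m} = insert i (G - {m})" using \<open>i \<noteq> m\<close> by auto
    ultimately show ?thesis
      using assms by (simp add: elt_sum_def m_def)
  qed
qed

text \<open>The pair \<open>G\<close>, \<open>a\<close> is the expression whose monomials are the \<open>a i * x ^ i\<close> with \<open>i \<in> G\<close>;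
  polynomials are the functions given by such expressions.\<close>

definition poly_fun ::
    "nat set \<Rightarrow> (nat \<Rightarrow> ('l :: comm_semiring_1, 'f :: linordered_ab_group_add) elt)
      \<Rightarrow> ('l, 'f) elt \<Rightarrow> ('l, 'f) elt" where
  "poly_fun G a x = elt_sum (\<lambda>i. a i * x ^ i) G"

definition elt_poly ::
    "(('l :: comm_semiring_1, 'f :: linordered_ab_group_add) elt \<Rightarrow> ('l, 'f) elt) \<Rightarrow> bool" where
  "elt_poly f \<longleftrightarrow> (\<exists>G a. finite G \<and> G \<noteq> {} \<and> f = poly_fun G a)"

text \<open>The only monomial of an expression cannot be deleted, since the empty sum has no value.\<close>

definition inessential ::
    "nat set \<Rightarrow> (nat \<Rightarrow> ('l :: comm_semiring_1, 'f :: linordered_ab_group_add) elt)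
      \<Rightarrow> nat \<Rightarrow> bool" where
  "inessential G a i \<longleftrightarrow>
    i \<in> G \<and> G - {i} \<noteq> {} \<and> (\<forall>x. poly_fun (G - {i}) a x = poly_fun G a x)"

text \<open>In one variable the monomials that are not inessential, with their coefficients, depend
  only on the function (for rational layers and real tangible values), so it does not matter
  which expression is chosen here.\<close>

definition elt_regular ::
    "(('l :: comm_semiring_1, 'f :: linordered_ab_group_add) elt \<Rightarrow> ('l, 'f) elt) \<Rightarrow> bool" where
  "elt_regular f \<longleftrightarrow>
    (\<exists>G a. finite G \<and> G \<noteq> {} \<and> f = poly_fun G a \<and>
      (\<forall>i\<in>G. \<not> inessential G a i \<longrightarrow> layer (a i) \<noteq> 0))"

definition const_fun :: "('a \<Rightarrow> 'b) \<Rightarrow> bool" where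
  "const_fun f \<longleftrightarrow> (\<exists>c. f = (\<lambda>_. c))"

text \<open>Products of polynomials are pointwise products of functions.\<close>

definition elt_irreducible ::
    "(('l :: comm_semiring_1, 'f :: linordered_ab_group_add) elt \<Rightarrow> ('l, 'f) elt) \<Rightarrow> bool" where
  "elt_irreducible f \<longleftrightarrow>
    elt_poly f \<and> \<not> const_fun f \<and>
    \<not> (\<exists>g h. elt_poly g \<and> elt_poly h \<and> \<not> const_fun g \<and> \<not> const_fun h \<and> f = g * h)"

text \<open>A factorization into irreducible factors is taken up to a constant, so that constant
  polynomials have the empty one.\<close>

definition irreducible_factorization ::
    "(('l :: comm_semiring_1, 'f :: linordered_ab_group_add) elt \<Rightarrow> ('l, 'f) elt)
      \<Rightarrow> (('l, 'f) elt \<Rightarrow> ('l, 'f) elt) multiset \<Rightarrow> bool" where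
  "irreducible_factorization f fs \<longleftrightarrow>
    (\<forall>g\<in>#fs. elt_irreducible g) \<and> (\<exists>c. f = (\<lambda>_. c) * prod_mset fs)"

definition eq_up_to_const ::
    "(('l :: comm_semiring_1, 'f :: linordered_ab_group_add) elt \<Rightarrow> ('l, 'f) elt)
      \<Rightarrow> (('l, 'f) elt \<Rightarrow> ('l, 'f) elt) \<Rightarrow> bool" where
  "eq_up_to_const g h \<longleftrightarrow> (\<exists>c. g = (\<lambda>_. c) * h)"

end

(* Over each tangible value s, the layer of f is a polynomial in the layer of the argument, the
   fibre of f over s; fibres are multiplicative, and regularity of f means that none of them
   vanishes, so that all factors of f have this property as well. Splitting off the corners of the
   tropical function of f from right to left, and factoring the fibre over each of them in Q[x],
   writes f as a constant times a product of basic functions: the variable, and the homogenizations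
   at tropical points t of monic irreducible q in Q[x] with q(0) nonzero. The number of times that
   such a pair (t, q) is used is the multiplicity of q in the fibre over t, and the number of
   variables is the multiplicity of x in the fibres far to the left; hence the basic factors are
   determined by f. This also shows that the basic functions are irreducible and, up to
   constants, the only irreducible factors of regular polynomials. *)

theory Submission
  imports Defs "HOL-Computational_Algebra.Polynomial_Factorial"
    "HOL-Computational_Algebra.Field_as_Ring"
begin

section \<open>Evaluation of polynomials\<close>

lemma tang_times [simp]: "tang (x * y) = tang x + tang y"
  and layer_times [simp]: "layer (x * y) = layer x * layer y"
  by (simp_all add: times_elt_def)

lemma tang_one [simp]: "tang 1 = 0"
  and layer_one [simp]: "layer 1 = 1"
  by (simp_all add: one_elt_def)

lemma layer_power [simp]: "layer (x ^ n) = layer x ^ n"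
  by (induction n) simp_all

lemma tang_power [simp]:
  fixes x :: "('l :: comm_semiring_1, 'f :: linordered_field) elt"
  shows "tang (x ^ n) = of_nat n * tang x"
  by (induction n) (simp_all add: algebra_simps)

text \<open>A term of smaller tangible value is absorbed, and layers over equal tangible values add.
  \<open>M\<close> is described as an attained upper bound, so that the induction hypothesis can be
  used at another value for the smaller set.\<close>

lemma elt_sum_eq_ELT:
  fixes h :: "nat \<Rightarrow> ('l :: comm_semiring_1, 'f :: linordered_ab_group_add) elt"
  assumes "finite G" "j \<in> G" "tang (h j) = M" "\<And>i. i \<in> G \<Longrightarrow> tang (h i) \<le> M"
  shows "elt_sum h G = ELT (\<Sum>i | i \<in> G \<and> tang (h i) = M. layer (h i)) M"
proof -
  have "G \<noteq> {}" using assms(2) by blast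
  from assms(1) this assms(2-) show ?thesis
  proof (induction arbitrary: M j rule: finite_ne_induct)
    case (singleton i)
    then have "{k. k \<in> {i} \<and> tang (h k) = M} = {i}" by auto
    with singleton show ?case by (cases "h i") (simp add: elt_sum_singleton)
  next
    case (insert i F)
    note sum = elt_sum_insert[OF insert.hyps(1,2,3), of h]
    show ?case
    proof (cases "\<exists>k\<in>F. tang (h k) = M")
      case True
      then obtain k where k: "k \<in> F" "tang (h k) = M" by blast
      have F: "elt_sum h F = ELT (\<Sum>i | i \<in> F \<and> tang (h i) = M. layer (h i)) M"
        using insert.IH[OF k] insert.prems(3) by blast
      show ?thesis
      proof (cases "tang (h i) = M")
        case True
        then have "{k. k \<in> insert i F \<and> tang (h k) = M} = insert i {k. k \<in> F \<and> tang (h k) = M}"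
          by auto
        with True insert.hyps show ?thesis
          unfolding sum F by (simp add: plus_elt_def)
      next
        case False
        then have "{k. k \<in> insert i F \<and> tang (h k) = M} = {k. k \<in> F \<and> tang (h k) = M}"
          by auto
        moreover have "tang (h i) < M" using False insert.prems(3)[of i] by simp
        ultimately show ?thesis
          unfolding sum F by (auto simp: plus_elt_def)
      qed
    next
      case False
      then have i: "tang (h i) = M" using insert.prems by auto
      \<comment> \<open>Only \<open>h i\<close> reaches \<open>M\<close> here, so the hypothesis is
        applied at the maximum \<open>N\<close> of \<open>F\<close>, which lies below
        \<open>M\<close>.\<close>
      define N where "N = Max ((\<lambda>k. tang (h k)) ` F)"
      have "N \<in> (\<lambda>k. tang (h k)) ` F"
        unfolding N_def using insert.hyps by (intro Max_in) auto
      then obtain k where k: "k \<in> F" "tang (h k) = N" by auto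
      have "tang (elt_sum h F) = N"
        using insert.IH[OF k] insert.hyps(1) by (simp add: N_def)
      moreover have "N < M" using k False insert.prems(3)[of k] by force
      moreover have "{k. k \<in> insert i F \<and> tang (h k) = M} = {i}" using False i by auto
      ultimately show ?thesis
        unfolding sum using i by (cases "h i") (simp add: plus_elt_def)
    qed
  qed
qed

text \<open>The tangible value of the monomial \<open>a i * x ^ i\<close> at an argument of tangible
  value \<open>s\<close>: an affine function of slope \<open>i\<close>.\<close>

definition line :: "(nat \<Rightarrow> ('l, 'f :: linordered_field) elt) \<Rightarrow> nat \<Rightarrow> 'f \<Rightarrow> 'f" where
  "line a i s = tang (a i) + of_nat i * s"

lemma line_shift: "line a i s = line a i t + of_nat i * (s - t)"
  by (simp add: line_def algebra_simps)

text \<open>Moving left from \<open>t\<close>, the line of larger slope drops by more.\<close>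

lemma line_less_left:
  assumes "line a i t \<le> line a j t" "j < i" "s < t"
  shows "line a i s < line a j s"
proof -
  have "of_nat i * (s - t) < of_nat j * (s - t)"
    using assms by (intro mult_strict_right_mono_neg) simp_all
  with assms(1) show ?thesis
    unfolding line_shift[of a _ s t] by (rule add_le_less_mono)
qed

lemma line_less_right:
  assumes "line a i t \<le> line a j t" "i < j" "t < s"
  shows "line a i s < line a j s"
proof -
  have "of_nat i * (s - t) < of_nat j * (s - t)"
    using assms by (intro mult_strict_right_mono) simp_all
  with assms(1) show ?thesis
    unfolding line_shift[of a _ s t] by (rule add_le_less_mono)
qed

text \<open>Only the lines through the maximum over \<open>s\<close> contribute, so the layer is a
  polynomial in \<open>l\<close>: the fibre over \<open>s\<close>.\<close>

lemma poly_fun_eq_ELT: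
  fixes a :: "nat \<Rightarrow> ('l :: comm_semiring_1, 'f :: linordered_field) elt"
  assumes "finite G" "j \<in> G" "\<And>i. i \<in> G \<Longrightarrow> line a i s \<le> line a j s"
  shows "poly_fun G a (ELT l s) =
    ELT (\<Sum>i | i \<in> G \<and> line a i s = line a j s. layer (a i) * l ^ i) (line a j s)"
  unfolding poly_fun_def line_def
  by (subst elt_sum_eq_ELT[OF assms(1,2) refl]) (use assms(3) in \<open>simp_all add: line_def\<close>)

text \<open>The lines outside \<open>G'\<close> stay strictly below the maximum over
  \<open>G'\<close>, so both index sets have the same dominant monomials.\<close>

lemma poly_fun_dominated:
  fixes a :: "nat \<Rightarrow> ('l :: comm_semiring_1, 'f :: linordered_field) elt"
  assumes "finite G" "G' \<subseteq> G" "j \<in> G'" "\<And>i. i \<in> G - G' \<Longrightarrow> line a i s < line a j s"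
  shows "poly_fun G a (ELT l s) = poly_fun G' a (ELT l s)"
proof -
  have fin: "finite G'" using assms(1,2) by (rule rev_finite_subset)
  define M where "M = Max ((\<lambda>i. line a i s) ` G')"
  have "M \<in> (\<lambda>i. line a i s) ` G'"
    unfolding M_def using assms(3) fin by (intro Max_in) auto
  then obtain k where k: "k \<in> G'" "line a k s = M" by auto
  have le: "line a i s \<le> line a k s" if "i \<in> G'" for i
    using that fin by (simp add: M_def k(2))
  have less: "line a i s < line a k s" if "i \<in> G - G'" for i
    using assms(4)[OF that] le[OF assms(3)] by simp
  have "{i. i \<in> G \<and> line a i s = line a k s} = {i. i \<in> G' \<and> line a i s = line a k s}"
    using less assms(2) by force
  moreover have "line a i s \<le> line a k s" if "i \<in> G" for i
    using that le less by (cases "i \<in> G'") (auto intro: less_imp_le)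
  ultimately show ?thesis
    using k(1) assms(2) fin le poly_fun_eq_ELT[OF assms(1), of k a s l]
      poly_fun_eq_ELT[of G' k a s l] by (auto simp: subset_iff)
qed

lemma poly_fun_singleton: "poly_fun {i} a x = a i * x ^ i"
  by (simp add: poly_fun_def elt_sum_singleton)

lemma poly_fun_insert:
  "finite G \<Longrightarrow> G \<noteq> {} \<Longrightarrow> i \<notin> G \<Longrightarrow> poly_fun (insert i G) a x = a i * x ^ i + poly_fun G a x"
  by (simp add: poly_fun_def elt_sum_insert)

lemma poly_fun_sole:
  fixes a :: "nat \<Rightarrow> ('l :: comm_semiring_1, 'f :: linordered_field) elt"
  assumes "finite G" "j \<in> G" "\<And>i. i \<in> G - {j} \<Longrightarrow> line a i s < line a j s"
  shows "poly_fun G a (ELT l s) = a j * ELT l s ^ j"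
  using poly_fun_dominated[of G "{j}" j a s l] assms by (simp add: poly_fun_singleton)

section \<open>Closure of polynomials under products\<close>

lemma poly_fun_cong:
  "finite G \<Longrightarrow> G \<noteq> {} \<Longrightarrow> (\<And>i. i \<in> G \<Longrightarrow> a i = b i) \<Longrightarrow> poly_fun G a x = poly_fun G b x"
  by (induction rule: finite_ne_induct) (simp_all add: poly_fun_singleton poly_fun_insert)

lemma elt_poly_poly_fun: "finite G \<Longrightarrow> G \<noteq> {} \<Longrightarrow> elt_poly (poly_fun G a)"
  unfolding elt_poly_def by blast

lemma elt_poly_monomial: "elt_poly (\<lambda>x. c * x ^ n)"
proof -
  have "(\<lambda>x. c * x ^ n) = poly_fun {n} (\<lambda>_. c)"
    by (simp add: fun_eq_iff poly_fun_singleton)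
  then show ?thesis by (simp add: elt_poly_poly_fun)
qed

lemma elt_poly_const: "elt_poly (\<lambda>_. c)"
  using elt_poly_monomial[of c 0] by simp

lemma elt_poly_add_monomial:
  assumes "elt_poly f"
  shows "elt_poly (\<lambda>x. c * x ^ n + f x)"
proof -
  from assms obtain G a where G: "finite G" "G \<noteq> {}" and f: "f = poly_fun G a"
    unfolding elt_poly_def by blast
  \<comment> \<open>An expression has one coefficient per exponent, so a monomial of exponent
    \<open>n\<close> that is already present is merged with the new one.\<close>
  define b where "b = a(n := if n \<in> G then c + a n else c)"
  have "c * x ^ n + f x = poly_fun (insert n G) b x" for x
  proof (cases "G - {n} = {}")
    \<comment> \<open>An empty expression has no meaningful value, so the case of the sole exponent
      \<open>n\<close> is treated apart.\<close>
    case True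
    then have "G = {n}" using G(2) by auto
    then show ?thesis by (simp add: f b_def poly_fun_singleton distrib_right)
  next
    case False
    have "poly_fun (G - {n}) b x = poly_fun (G - {n}) a x"
      by (rule poly_fun_cong) (use G False in \<open>auto simp: b_def\<close>)
    then have eq: "poly_fun (insert n G) b x = b n * x ^ n + poly_fun (G - {n}) a x"
      using poly_fun_insert[of "G - {n}" n b x] G False by simp
    show ?thesis
    proof (cases "n \<in> G")
      case True
      then have "f x = a n * x ^ n + poly_fun (G - {n}) a x"
        using poly_fun_insert[of "G - {n}" n a x] G False by (simp add: f insert_absorb)
      with True eq show ?thesis by (simp add: b_def distrib_right add.assoc)
    next
      case False
      with eq show ?thesis by (simp add: b_def f)
    qed
  qed
  then have "(\<lambda>x. c * x ^ n + f x) = poly_fun (insert n G) b" by blast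
  with G show ?thesis by (simp add: elt_poly_poly_fun)
qed

lemma elt_poly_add:
  assumes "elt_poly f" "elt_poly g"
  shows "elt_poly (\<lambda>x. f x + g x)"
proof -
  from assms(1) obtain G a where "finite G" "G \<noteq> {}" and f: "f = poly_fun G a"
    unfolding elt_poly_def by blast
  then have "elt_poly (\<lambda>x. poly_fun G a x + g x)"
  proof (induction arbitrary: f rule: finite_ne_induct)
    case (singleton i)
    show ?case using elt_poly_add_monomial[OF assms(2)] by (simp add: poly_fun_singleton)
  next
    case (insert i F)
    show ?case
      using elt_poly_add_monomial[OF insert.IH[OF refl], of "a i" i] insert.hyps
      by (simp add: poly_fun_insert add.assoc)
  qed
  then show ?thesis by (simp add: f)
qed

lemma elt_poly_mult_monomial:
  assumes "elt_poly f"
  shows "elt_poly (\<lambda>x. c * x ^ n * f x)"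
proof -
  from assms obtain G a where "finite G" "G \<noteq> {}" and f: "f = poly_fun G a"
    unfolding elt_poly_def by blast
  then have "elt_poly (\<lambda>x. c * x ^ n * poly_fun G a x)"
  proof (induction arbitrary: f rule: finite_ne_induct)
    case (singleton i)
    have "(\<lambda>x. c * x ^ n * poly_fun {i} a x) = (\<lambda>x. (c * a i) * x ^ (n + i))"
      by (simp add: fun_eq_iff poly_fun_singleton power_add mult.assoc mult.left_commute)
    then show ?case by (simp add: elt_poly_monomial)
  next
    case (insert i F)
    have "(\<lambda>x. c * x ^ n * poly_fun (insert i F) a x) =
        (\<lambda>x. (c * a i) * x ^ (n + i) + c * x ^ n * poly_fun F a x)"
      using insert.hyps
      by (simp add: fun_eq_iff poly_fun_insert power_add distrib_left mult.assoc mult.left_commute)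
    then show ?case using elt_poly_add_monomial[OF insert.IH[OF refl]] by simp
  qed
  then show ?thesis by (simp add: f)
qed

lemma elt_poly_mult:
  assumes "elt_poly f" "elt_poly g"
  shows "elt_poly (f * g)"
proof -
  from assms(1) obtain G a where "finite G" "G \<noteq> {}" and f: "f = poly_fun G a"
    unfolding elt_poly_def by blast
  then have "elt_poly (\<lambda>x. poly_fun G a x * g x)"
  proof (induction arbitrary: f rule: finite_ne_induct)
    case (singleton i)
    show ?case using elt_poly_mult_monomial[OF assms(2)] by (simp add: poly_fun_singleton)
  next
    case (insert i F)
    show ?case
      using elt_poly_add[OF elt_poly_mult_monomial[OF assms(2), of "a i" i] insert.IH[OF refl]]
        insert.hyps
      by (simp add: poly_fun_insert distrib_right)
  qed
  then show ?thesis by (simp add: f times_fun_def)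
qed

lemma elt_poly_prod_mset: "(\<And>g. g \<in># fs \<Longrightarrow> elt_poly g) \<Longrightarrow> elt_poly (prod_mset fs)"
proof (induction fs)
  case empty
  show ?case using elt_poly_const[of 1] by (simp add: one_fun_def)
next
  case (add g fs)
  then have "elt_poly (g * prod_mset fs)" by (intro elt_poly_mult) simp_all
  then show ?case by (simp only: prod_mset.add_mset)
qed

section \<open>Regular polynomials have no degenerate fibre\<close>

text \<open>A consequence of regularity that refers to values only and not to an expression, and so
  passes to the factors of a product directly.\<close>

definition nondegenerate :: "(('l :: zero, 'f) elt \<Rightarrow> ('l, 'f) elt) \<Rightarrow> bool" where
  "nondegenerate f \<longleftrightarrow> (\<forall>s. \<exists>l. layer (f (ELT l s)) \<noteq> 0)"

lemma nondegenerate_multD: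
  fixes f g :: "('l :: comm_semiring_1, 'f :: linordered_ab_group_add) elt \<Rightarrow> ('l, 'f) elt"
  assumes "nondegenerate (f * g)"
  shows "nondegenerate f" "nondegenerate g"
  using assms unfolding nondegenerate_def times_fun_apply layer_times mult_zero_left mult_zero_right
  by (metis mult_zero_left, metis mult_zero_right)

lemma nondegenerate_prod_msetD:
  fixes fs :: "(('l :: comm_semiring_1, 'f :: linordered_ab_group_add) elt \<Rightarrow> ('l, 'f) elt) multiset"
  assumes "nondegenerate (prod_mset fs)" "g \<in># fs"
  shows "nondegenerate g"
  using assms nondegenerate_multD(1)[of g "prod_mset (fs - {#g#})"]
  by (metis insert_DiffM prod_mset.add_mset)

text \<open>Slightly to the left of \<open>t\<close>, the least exponent among the dominant monomials at \<open>t\<close> wins.\<close>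

lemma least_dominant_sole:
  fixes a :: "nat \<Rightarrow> ('l, real) elt"
  assumes "finite G"
    and "\<And>i. i \<in> G - {j} \<Longrightarrow> line a i t < line a j t \<or> line a i t = line a j t \<and> j < i"
  obtains s where "\<And>i. i \<in> G - {j} \<Longrightarrow> line a i s < line a j s"
proof -
  have "eventually (\<lambda>s. line a i s < line a j s) (at_left t)" if "i \<in> G - {j}" for i
  proof (cases "line a i t < line a j t")
    case True
    have "((\<lambda>s. line a j s - line a i s) \<longlongrightarrow> line a j t - line a i t) (at_left t)"
      unfolding line_def by (intro tendsto_intros)
    then have "eventually (\<lambda>s. 0 < line a j s - line a i s) (at_left t)"
      by (rule order_tendstoD) (use True in simp)
    then show ?thesis by (simp add: algebra_simps)
  next
    case False
    with assms(2)[OF that] have "line a i t \<le> line a j t" "j < i" by auto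
    moreover have "eventually (\<lambda>s. s < t) (at_left t)"
      by (simp add: eventually_at_filter)
    ultimately show ?thesis by (auto elim!: eventually_mono intro: line_less_left)
  qed
  then have "eventually (\<lambda>s. \<forall>i\<in>G - {j}. line a i s < line a j s) (at_left t)"
    using assms(1) by (intro eventually_ball_finite) auto
  then obtain s where "\<forall>i\<in>G - {j}. line a i s < line a j s"
    using eventually_happens[of _ "at_left t"] by auto
  with that show thesis by blast
qed

text \<open>Over \<open>s\<close>, deleting the monomial of exponent \<open>j\<close> lowers the
  tangible value to the maximum of the other lines.\<close>

lemma sole_not_inessential:
  fixes a :: "nat \<Rightarrow> ('l :: comm_semiring_1, 'f :: linordered_field) elt"
  assumes "finite G" "j \<in> G" "\<And>i. i \<in> G - {j} \<Longrightarrow> line a i s < line a j s"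
  shows "\<not> inessential G a j"
proof
  assume "inessential G a j"
  then have ne: "G - {j} \<noteq> {}" and eq: "poly_fun (G - {j}) a (ELT 1 s) = poly_fun G a (ELT 1 s)"
    unfolding inessential_def by auto
  define M where "M = Max ((\<lambda>i. line a i s) ` (G - {j}))"
  have "M \<in> (\<lambda>i. line a i s) ` (G - {j})"
    unfolding M_def using assms(1) ne by (intro Max_in) auto
  then obtain k where k: "k \<in> G - {j}" "line a k s = M" by auto
  have "tang (poly_fun (G - {j}) a (ELT 1 s)) = line a k s"
    by (subst poly_fun_eq_ELT[OF _ k(1)]) (use assms(1) k in \<open>simp_all add: M_def\<close>)
  moreover have "tang (poly_fun G a (ELT 1 s)) = line a j s"
    using poly_fun_sole[OF assms, of 1] by (simp add: line_def)
  ultimately show False using assms(3)[OF k(1)] eq by simp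
qed

text \<open>The least exponent \<open>j\<close> that is dominant over \<open>t\<close> is the only
  dominant one over some other point \<open>s\<close>. Hence its monomial is essential, and
  \<open>layer (a j)\<close>, the coefficient of lowest exponent in the fibre over \<open>t\<close>,
  is nonzero.\<close>

lemma elt_regular_imp_nondegenerate:
  fixes f :: "('l :: {idom, ring_char_0}, real) elt \<Rightarrow> ('l, real) elt"
  assumes "elt_regular f"
  shows "nondegenerate f"
  unfolding nondegenerate_def
proof
  fix t
  from assms obtain G a where G: "finite G" "G \<noteq> {}" and f: "f = poly_fun G a"
    and reg: "\<And>i. i \<in> G \<Longrightarrow> \<not> inessential G a i \<Longrightarrow> layer (a i) \<noteq> 0"
    unfolding elt_regular_def by blast
  define M where "M = Max ((\<lambda>i. line a i t) ` G)"
  define A where "A = {i. i \<in> G \<and> line a i t = M}"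
  have "M \<in> (\<lambda>i. line a i t) ` G"
    unfolding M_def using G by (intro Max_in) auto
  then have A: "A \<noteq> {}" "finite A" using G by (auto simp: A_def)
  define j where "j = Min A"
  have "j \<in> A" using A by (simp add: j_def)
  then have j: "j \<in> G" "line a j t = M" by (auto simp: A_def)
  have le: "line a i t \<le> line a j t" if "i \<in> G" for i
    using that G by (simp add: j M_def)
  have "line a i t < line a j t \<or> line a i t = line a j t \<and> j < i" if "i \<in> G - {j}" for i
  proof (cases "i \<in> A")
    case True
    then have "j \<le> i" using A by (simp add: j_def)
    with that True j show ?thesis by (auto simp: A_def)
  next
    case False
    with that le[of i] j show ?thesis by (auto simp: A_def)
  qed
  from least_dominant_sole[OF G(1) this] obtain s
    where "\<And>i. i \<in> G - {j} \<Longrightarrow> line a i s < line a j s" by blast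
  then have nz: "layer (a j) \<noteq> 0"
    using reg sole_not_inessential G(1) j(1) by blast
  define p where "p = (\<Sum>i\<in>A. monom (layer (a i)) i)"
  have "coeff p j = layer (a j)"
    using A \<open>j \<in> A\<close> by (simp add: p_def coeff_sum)
  then have "p \<noteq> 0" using nz by auto
  \<comment> \<open>A domain of characteristic 0 is infinite, so a nonzero polynomial is not the
    zero function on it.\<close>
  then have "poly p \<noteq> poly 0" by (simp only: poly_eq_poly_eq_iff) simp
  then obtain l where "poly p l \<noteq> 0" by (auto simp: fun_eq_iff)
  moreover have "layer (f (ELT l t)) = poly p l"
    using poly_fun_eq_ELT[OF G(1) j(1) le, of l] j
    by (simp add: f p_def poly_sum poly_monom A_def)
  ultimately show "\<exists>l. layer (f (ELT l t)) \<noteq> 0" by metis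
qed

section \<open>Polynomials with a single corner\<close>

text \<open>The homogenization of \<open>q\<close> with all its monomials dominant at \<open>t\<close>.\<close>

definition corner :: "real \<Rightarrow> 'l :: comm_ring_1 poly \<Rightarrow> ('l, real) elt \<Rightarrow> ('l, real) elt" where
  "corner t q x =
    (if tang x < t then ELT (coeff q 0) 0
     else if t < tang x then ELT (lead_coeff q * layer x ^ degree q) (real (degree q) * (tang x - t))
     else ELT (poly q (layer x)) 0)"

lemma elt_poly_corner: "elt_poly (corner t q)"
proof -
  \<comment> \<open>These tangible values make all lines meet at height 0 over \<open>t\<close>.
    Zero coefficients of \<open>q\<close> remain as monomials of layer 0, as there is no additive
    zero.\<close>
  define a where "a = (\<lambda>i. ELT (coeff q i) (- (real i * t)))"
  have line: "line a i s = real i * (s - t)" for i s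
    by (simp add: a_def line_def algebra_simps)
  have "corner t q x = poly_fun {..degree q} a x" for x
  proof (cases x)
    case (ELT l s)
    consider "s < t" | "t < s" | "s = t" by linarith
    then show ?thesis
    proof cases
      case 1
      then have "poly_fun {..degree q} a (ELT l s) = a 0 * ELT l s ^ 0"
        by (intro poly_fun_sole) (auto simp: line mult_less_0_iff)
      with 1 ELT show ?thesis by (simp add: corner_def a_def)
    next
      case 2
      then have "poly_fun {..degree q} a (ELT l s) = a (degree q) * ELT l s ^ degree q"
        by (intro poly_fun_sole) (auto simp: line)
      with 2 ELT show ?thesis
        by (auto simp: corner_def a_def algebra_simps intro!: elt.expand)
    next
      case 3
      with ELT show ?thesis
        using poly_fun_eq_ELT[of "{..degree q}" 0 a s l]
        by (simp add: corner_def line poly_altdef atMost_def) (simp add: a_def)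
    qed
  qed
  then have "corner t q = poly_fun {..degree q} a" by blast
  then show ?thesis by (simp add: elt_poly_poly_fun)
qed

lemma corner_1 [simp]: "corner t 1 = 1"
  by (auto simp: fun_eq_iff corner_def one_elt_def)

text \<open>The constant term, the leading coefficient and evaluation are multiplicative, and
  degrees of nonzero polynomials add; these data describe a corner to the left of \<open>t\<close>,
  to the right of it and at \<open>t\<close>.\<close>

lemma corner_mult:
  fixes p q :: "'l :: idom poly"
  assumes "p \<noteq> 0" "q \<noteq> 0"
  shows "corner t (p * q) = corner t p * corner t q"
proof
  fix x
  show "corner t (p * q) x = (corner t p * corner t q) x"
    using assms
    by (simp add: corner_def times_elt_def coeff_mult_0 lead_coeff_mult degree_mult_eq power_add
        algebra_simps flip: coeff_degree_mult)
qed

lemma corner_prod_mset: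
  fixes A :: "'l :: idom poly multiset"
  assumes "0 \<notin># A"
  shows "corner t (prod_mset A) = prod_mset (image_mset (corner t) A)"
  using assms by (induction A) (auto simp: corner_mult)

text \<open>The normal forms of the irreducible nondegenerate polynomials: the variable itself, and
  the corners given by monic irreducible polynomials with nonzero constant term.\<close>

fun basic :: "(real \<times> rat poly) option \<Rightarrow> (rat, real) elt \<Rightarrow> (rat, real) elt" where
  "basic None = (\<lambda>x. x)"
| "basic (Some (t, q)) = corner t q"

text \<open>The condition on \<open>coeff q 0\<close> excludes \<open>[:0, 1:]\<close>, whose corner
  has layer 0 everywhere to the left of \<open>t\<close>. A \<open>prime\<close> polynomial is
  normalized, hence monic, which fixes the constant factor.\<close>

fun basic_index :: "(real \<times> rat poly) option \<Rightarrow> bool" where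
  "basic_index None \<longleftrightarrow> True"
| "basic_index (Some (t, q)) \<longleftrightarrow> prime q \<and> coeff q 0 \<noteq> 0"

text \<open>The layer of \<open>basic k\<close> over \<open>s\<close> as an element of
  \<open>rat poly\<close>, where multiplicities of primes are available.\<close>

fun fibre :: "(real \<times> rat poly) option \<Rightarrow> real \<Rightarrow> rat poly" where
  "fibre None s = [:0, 1:]"
| "fibre (Some (t, q)) s =
    (if s < t then [:coeff q 0:] else if t < s then monom (lead_coeff q) (degree q) else q)"

lemma layer_basic: "layer (basic k (ELT l s)) = poly (fibre k s) l"
proof (cases k)
  case (Some tq)
  then show ?thesis by (cases tq) (auto simp: corner_def poly_monom)
qed simp

lemma fibre_nonzero: "basic_index k \<Longrightarrow> fibre k s \<noteq> 0"
  by (cases "(k, s)" rule: fibre.cases) (auto simp: monom_eq_0_iff)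

lemma elt_poly_basic: "elt_poly (basic k)"
proof (cases k)
  case None
  then show ?thesis using elt_poly_monomial[of 1 1] by simp
next
  case (Some tq)
  then show ?thesis by (cases tq) (simp add: elt_poly_corner)
qed

lemma degree_prime_pos:
  fixes q :: "'a :: {field_gcd} poly"
  assumes "prime q"
  shows "degree q > 0"
proof (rule ccontr)
  assume "\<not> degree q > 0"
  then obtain c where "q = [:c:]" using degree_eq_zeroE by blast
  with assms show False
    by (metis is_unit_const_poly_iff dvd_field_iff not_prime_0 not_prime_unit pCons_0_0)
qed

lemma basic_not_const:
  assumes "basic_index k"
  shows "\<not> const_fun (basic k)"
proof
  assume "const_fun (basic k)"
  then obtain c where c: "basic k x = c" for x
    unfolding const_fun_def by auto
  show False
  proof (cases k)
    case None
    have "basic k (ELT 0 0) = basic k (ELT 1 0)" by (simp only: c)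
    with None show False by simp
  next
    case (Some tq)
    obtain t q where "tq = (t, q)" by fastforce
    \<comment> \<open>The tangible value is \<open>degree q > 0\<close> at the first point and 0 at
      the second.\<close>
    moreover have "basic k (ELT 0 (t + 1)) = basic k (ELT 0 (t - 1))" by (simp only: c)
    ultimately show False
      using assms Some degree_prime_pos[of q] by (simp add: corner_def)
  qed
qed

section \<open>Existence of factorizations\<close>

text \<open>Multiplicativity of \<open>corner t\<close> carries the prime factorization of
  \<open>q\<close> over to functions. The unit factor becomes the constant, and the prime factors
  inherit the nonzero constant term.\<close>

lemma corner_factorization:
  fixes q :: "rat poly"
  assumes "coeff q 0 \<noteq> 0"
  obtains c K where "\<And>k. k \<in># K \<Longrightarrow> basic_index k"
    and "corner t q = (\<lambda>_. c) * prod_mset (image_mset basic K)"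
proof
  define A where "A = prime_factorization q"
  define u where "u = unit_factor q"
  have q: "q \<noteq> 0" using assms by auto
  have u: "u \<noteq> 0" "q = u * prod_mset A"
    using q by (simp_all add: u_def A_def prod_mset_prime_factorization)
  have A: "prime p" "p dvd q" if "p \<in># A" for p
    using that by (auto simp: A_def in_prime_factors_iff)
  have "0 \<notin># A" using A by fastforce
  have "degree u = 0"
    by (simp add: u_def unit_factor_poly_def)
  then have "corner t u = (\<lambda>_. ELT (lead_coeff u) 0)"
    by (auto simp: fun_eq_iff corner_def elim: degree_eq_zeroE)
  moreover have "prod_mset A \<noteq> 0" using u q by auto
  ultimately have "corner t q = (\<lambda>_. ELT (lead_coeff u) 0) * prod_mset (image_mset (corner t) A)"
    using u \<open>0 \<notin># A\<close> by (simp add: corner_mult corner_prod_mset)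
  moreover have "image_mset (corner t) A = image_mset basic (image_mset (\<lambda>p. Some (t, p)) A)"
    by (simp add: multiset.map_comp o_def)
  ultimately show "corner t q = (\<lambda>_. ELT (lead_coeff u) 0) *
      prod_mset (image_mset basic (image_mset (\<lambda>p. Some (t, p)) A))"
    by simp
  show "basic_index k" if "k \<in># image_mset (\<lambda>p. Some (t, p)) A" for k
  proof -
    from that obtain p where p: "p \<in># A" "k = Some (t, p)" by auto
    then obtain r where "q = p * r" using A(2) by blast
    then have "coeff p 0 \<noteq> 0" using assms by (auto simp: coeff_mult_0)
    with p A(1) show ?thesis by simp
  qed
qed

text \<open>Here \<open>t\<close> is the largest tropical root and \<open>J\<close> the least exponent of a monomial that is dominant
  there. To the left of \<open>t\<close> only the exponents up to \<open>J\<close> matter, to the right only the largest one.\<close>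

lemma split_largest_corner:
  fixes a :: "nat \<Rightarrow> ('l :: field, real) elt"
  assumes G: "finite G" "G \<noteq> {}" and two: "G \<noteq> {Max G}" and nd: "nondegenerate (poly_fun G a)"
  obtains t q J where "coeff q 0 \<noteq> 0" "J \<in> G" "J < Max G"
    and "poly_fun G a = corner t q * poly_fun {i \<in> G. i \<le> J} a"
proof -
  \<comment> \<open>Where one monomial alone is dominant, it is the whole fibre, and nondegeneracy
    forces its layer to be nonzero.\<close>
  have sole_nonzero: "layer (a j) \<noteq> 0"
    if "j \<in> G" "\<And>i. i \<in> G - {j} \<Longrightarrow> line a i s < line a j s" for j s
  proof -
    from nd obtain l where "layer (poly_fun G a (ELT l s)) \<noteq> 0"
      unfolding nondegenerate_def by blast
    with poly_fun_sole[OF G(1) that] show ?thesis by auto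
  qed
  define N where "N = Max G"
  have N: "N \<in> G" "i \<in> G \<Longrightarrow> i \<le> N" for i using G by (auto simp: N_def)
  define H where "H = G - {N}"
  have H: "finite H" "H \<noteq> {}" using G two N(1) by (auto simp: H_def N_def)
  have less_N: "i < N" if "i \<in> H" for i using that N(2)[of i] by (auto simp: H_def)
  \<comment> \<open>The lines of \<open>i\<close> and \<open>N\<close> cross at
    \<open>root i\<close>, and from there on \<open>N\<close> has the larger slope and the larger
    value.\<close>
  define root where "root i = (tang (a i) - tang (a N)) / (real N - real i)" for i
  have line_root: "line a i s \<le> line a N s \<longleftrightarrow> root i \<le> s" if "i \<in> H" for i s
    using less_N[OF that] by (simp add: root_def line_def field_simps)
  define t where "t = Max (root ` H)"
  have "t \<in> root ` H" unfolding t_def using H by (intro Max_in) auto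
  then obtain i0 where i0: "i0 \<in> H" "root i0 = t" by auto
  have root_le: "root i \<le> t" if "i \<in> H" for i using that H by (simp add: t_def)
  have le: "line a i t \<le> line a N t" if "i \<in> G" for i
    using that line_root[of i t] root_le[of i] by (cases "i = N") (auto simp: H_def)
  have i0_eq: "line a i0 t = line a N t"
    using i0 less_N[OF i0(1)] by (auto simp: root_def line_def field_simps)
  define A where "A = {i \<in> G. line a i t = line a N t}"
  have A: "finite A" "N \<in> A" "i0 \<in> A"
    using G N i0 i0_eq by (auto simp: A_def H_def)
  define J where "J = Min A"
  have "J \<in> A" using A Min_in[of A] unfolding J_def by blast
  then have J: "J \<in> G" "line a J t = line a N t" by (auto simp: A_def)
  have J_le: "J \<le> i" if "i \<in> A" for i using that A by (simp add: J_def)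
  have "J < N" using J_le[OF A(3)] less_N[OF i0(1)] by simp
  have leJ: "line a i t \<le> line a J t" if "i \<in> G" for i using le[OF that] J by simp
  have dom: "line a i t < line a J t \<or> line a i t = line a J t \<and> J < i" if "i \<in> G - {J}" for i
    using leJ[of i] J_le[of i] J that by (force simp: A_def)
  obtain s where "\<And>i. i \<in> G - {J} \<Longrightarrow> line a i s < line a J s"
    using least_dominant_sole[OF G(1) dom] by blast
  then have aJ: "layer (a J) \<noteq> 0" using sole_nonzero J by blast
  have N_sole: "line a i s < line a N s" if "i \<in> G - {N}" "t < s" for i s
    using line_less_right[OF le] that N(2)[of i] by force
  then have aN: "layer (a N) \<noteq> 0"
    using sole_nonzero[OF N(1), of "t + 1"] by simp
  \<comment> \<open>The fibre over \<open>t\<close> consists of the terms with coefficients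
    \<open>layer (a i)\<close> for \<open>i \<in> A\<close>. Dividing it by its lowest term, of
    exponent \<open>J\<close>, leaves \<open>q\<close>, with constant term 1.\<close>
  define q where "q = (\<Sum>i\<in>A. monom (layer (a i) / layer (a J)) (i - J))"
  have coeff_q: "coeff q (i - J) = layer (a i) / layer (a J)" if "i \<in> A" for i
  proof -
    have "coeff q (i - J) = (\<Sum>k\<in>A. if k = i then layer (a i) / layer (a J) else 0)"
      unfolding q_def coeff_sum using J_le that
      by (intro sum.cong) (auto simp: coeff_monom eq_diff_iff)
    with that A show ?thesis by simp
  qed
  have q0: "coeff q 0 = 1" using coeff_q[OF \<open>J \<in> A\<close>] aJ by simp
  have "degree q \<le> N - J"
    unfolding q_def using A N(2)
    by (intro degree_sum_le) (auto intro!: order.trans[OF degree_monom_le] diff_le_mono simp: A_def)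
  then have deg: "degree q = N - J"
    using coeff_q[OF A(2)] aN aJ le_degree[of q "N - J"] by simp
  have lead: "lead_coeff q = layer (a N) / layer (a J)"
    using coeff_q[OF A(2)] by (simp add: deg)
  define G' where "G' = {i \<in> G. i \<le> J}"
  have G': "finite G'" "J \<in> G'" "G' \<subseteq> G" using G J by (auto simp: G'_def)
  \<comment> \<open>Exponents below \<open>J\<close> are not dominant over \<open>t\<close>, so
    their lines are strictly lower there, and their smaller slopes keep them lower to the
    right.\<close>
  have J_sole: "poly_fun G' a (ELT l s) = a J * ELT l s ^ J" if "t \<le> s" for l s
  proof (rule poly_fun_sole[OF G'(1,2)])
    fix i assume i: "i \<in> G' - {J}"
    then have "i \<in> G - {J}" "i < J" by (auto simp: G'_def)
    with dom[of i] have "line a i t < line a J t" by auto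
    with \<open>i < J\<close> that show "line a i s < line a J s"
      using line_less_right[of a i t J s] by (cases "s = t") auto
  qed
  have "poly_fun G a x = corner t q x * poly_fun G' a x" for x
  proof (cases x)
    case (ELT l s)
    consider "s < t" | "t < s" | "s = t" by linarith
    then show ?thesis
    proof cases
      case 1
      have "poly_fun G a (ELT l s) = poly_fun G' a (ELT l s)"
      proof (rule poly_fun_dominated[OF G(1) G'(3,2)])
        fix i assume "i \<in> G - G'"
        then show "line a i s < line a J s"
          using 1 leJ[of i] by (intro line_less_left[of _ _ t]) (auto simp: G'_def)
      qed
      moreover have "corner t q x = 1" using 1 ELT q0 by (simp add: corner_def one_elt_def)
      ultimately show ?thesis by (simp add: ELT)
    next
      case 2
      have "poly_fun G a (ELT l s) = a N * ELT l s ^ N"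
        using poly_fun_sole[OF G(1) N(1) N_sole] 2 by blast
      moreover have "corner t q x =
          ELT (layer (a N) / layer (a J) * l ^ (N - J)) (real (N - J) * (s - t))"
        using 2 ELT lead deg by (simp add: corner_def)
      moreover have "l ^ N = l ^ (N - J) * l ^ J"
        using \<open>J < N\<close> by (simp flip: power_add)
      \<comment> \<open>The lines of \<open>N\<close> and \<open>J\<close> meet over
        \<open>t\<close>, so over \<open>s\<close> they differ by exactly the tangible value of the
        corner.\<close>
      moreover have "tang (a N) + real N * s = real (N - J) * (s - t) + (tang (a J) + real J * s)"
        using J(2) \<open>J < N\<close> by (simp add: line_def of_nat_diff algebra_simps)
      ultimately show ?thesis
        using 2 aJ by (auto simp: ELT J_sole intro!: elt.expand)
    next
      case 3
      have "poly q l * layer (a J) * l ^ J = (\<Sum>i\<in>A. layer (a i) * l ^ i)"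
        unfolding q_def poly_sum sum_distrib_right
      proof (rule sum.cong)
        fix i assume "i \<in> A"
        then have "l ^ i = l ^ (i - J) * l ^ J" using J_le by (simp flip: power_add)
        then show "poly (monom (layer (a i) / layer (a J)) (i - J)) l * layer (a J) * l ^ J =
            layer (a i) * l ^ i"
          using aJ by (simp add: poly_monom)
      qed simp
      moreover have "poly_fun G a (ELT l t) = ELT (\<Sum>i\<in>A. layer (a i) * l ^ i) (line a N t)"
        using poly_fun_eq_ELT[OF G(1) N(1) le, of l] by (simp add: A_def)
      moreover have "corner t q x = ELT (poly q l) 0" using 3 ELT by (simp add: corner_def)
      moreover have "line a N t = tang (a J) + real J * t" using J by (simp add: line_def)
      ultimately show ?thesis
        using 3 by (auto simp: ELT J_sole mult.assoc intro!: elt.expand)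
    qed
  qed
  then have "poly_fun G a = corner t q * poly_fun {i \<in> G. i \<le> J} a"
    by (auto simp: fun_eq_iff G'_def)
  with q0 J \<open>J < N\<close> show thesis by (intro that[of q J t]) (simp_all add: N_def)
qed

text \<open>Splitting off the rightmost corner removes at least the largest exponent, and the
  remaining factor is again nondegenerate. The process ends with a single monomial, a constant times
  a power of the variable.\<close>

lemma poly_fun_factorization:
  fixes a :: "nat \<Rightarrow> (rat, real) elt"
  assumes "finite G" "G \<noteq> {}" "nondegenerate (poly_fun G a)"
  shows "\<exists>c K. (\<forall>k\<in>#K. basic_index k) \<and>
    poly_fun G a = (\<lambda>_. c) * prod_mset (image_mset basic K)"
  using assms
proof (induction "card G" arbitrary: G rule: less_induct)
  case less
  show ?case
  proof (cases "G = {Max G}")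
    case True
    have "prod_mset (replicate_mset n (\<lambda>x. x)) x = x ^ n" for n and x :: "(rat, real) elt"
      by (induction n) auto
    then have "poly_fun G a = (\<lambda>_. a (Max G)) * prod_mset (image_mset basic (replicate_mset (Max G) None))"
      by (subst True) (simp add: fun_eq_iff poly_fun_singleton)
    then show ?thesis by (intro exI[of _ "a (Max G)"] exI[of _ "replicate_mset (Max G) None"]) simp
  next
    case False
    then obtain t q J where q: "coeff q 0 \<noteq> 0" and J: "J \<in> G" "J < Max G"
      and eq: "poly_fun G a = corner t q * poly_fun {i \<in> G. i \<le> J} a"
      using split_largest_corner[OF less.prems(1,2) False less.prems(3)] by blast
    let ?G' = "{i \<in> G. i \<le> J}"
    have "Max G \<in> G" using less.prems by simp
    with J have "card ?G' < card G"
      using less.prems(1) by (intro psubset_card_mono) force+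
    moreover have "nondegenerate (poly_fun ?G' a)"
      by (rule nondegenerate_multD(2)) (use less.prems(3) in \<open>simp only: eq\<close>)
    ultimately obtain c K where K: "\<And>k. k \<in># K \<Longrightarrow> basic_index k"
      "poly_fun ?G' a = (\<lambda>_. c) * prod_mset (image_mset basic K)"
      using less.hyps[of ?G'] less.prems(1) J(1) by auto
    obtain d L where L: "\<And>k. k \<in># L \<Longrightarrow> basic_index k"
      "corner t q = (\<lambda>_. d) * prod_mset (image_mset basic L)"
      using corner_factorization[OF q] by metis
    have "poly_fun G a = (\<lambda>_. d * c) * prod_mset (image_mset basic (L + K))"
      unfolding eq K L by (simp add: fun_eq_iff mult.assoc mult.left_commute)
    with K(1) L(1) show ?thesis by (intro exI[of _ "d * c"] exI[of _ "L + K"]) auto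
  qed
qed

lemma nondegenerate_factorization:
  fixes f :: "(rat, real) elt \<Rightarrow> (rat, real) elt"
  assumes "elt_poly f" "nondegenerate f"
  obtains c K where "\<And>k. k \<in># K \<Longrightarrow> basic_index k"
    and "f = (\<lambda>_. c) * prod_mset (image_mset basic K)"
  using assms poly_fun_factorization unfolding elt_poly_def by metis

section \<open>Uniqueness\<close>

lemma layer_prod_basic:
  "layer (prod_mset (image_mset basic K) (ELT l s)) = poly (prod_mset (image_mset (\<lambda>k. fibre k s) K)) l"
  by (induction K) (simp_all add: layer_basic)

lemma prime_X: "prime [:0, 1 :: 'a :: field_gcd:]"
  by (simp add: prime_def prime_elem_linear_field_poly normalize_poly_eq_map_poly)

text \<open>The index \<open>Some (t, q)\<close> is detected by the prime \<open>q\<close> over \<open>t\<close>, and \<open>None\<close> by the variable over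
  a point to the left of all corners.\<close>

lemma prime_detecting_index:
  fixes S :: "(real \<times> rat poly) option set"
  assumes "finite S" "\<And>k. k \<in> S \<Longrightarrow> basic_index k" "k0 \<in> S"
  obtains p s where "prime p" "\<And>k. k \<in> S \<Longrightarrow> multiplicity p (fibre k s) = (if k = k0 then 1 else 0)"
proof -
  have const: "multiplicity p [:c:] = 0" if "prime p" "c \<noteq> 0" for p and c :: rat
  proof (rule not_dvd_imp_multiplicity_0)
    have "is_unit [:c:]" using that by (simp add: is_unit_const_poly_iff dvd_field_iff)
    then show "\<not> p dvd [:c:]" using that(1) not_prime_unit dvd_unit_imp_unit by blast
  qed
  show thesis
  proof (cases k0)
    case None
    define T where "T = {t. \<exists>q. Some (t, q) \<in> S}"
    have "T \<subseteq> (\<lambda>k. fst (the k)) ` S" by (force simp: T_def)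
    then have "finite T" using assms(1) finite_surj by blast
    \<comment> \<open>The \<open>0\<close> keeps the minimum defined if there are no corners.
      Subtracting 1 puts \<open>s\<close> strictly to the left of all corners, where their fibres
      are nonzero constants.\<close>
    define s where "s = Min (insert 0 T) - 1"
    have s: "s < t" if "Some (t, q) \<in> S" for t q
    proof -
      have "Min (insert 0 T) \<le> t"
        using that \<open>finite T\<close> by (intro Min_le) (auto simp: T_def)
      then show ?thesis by (simp add: s_def)
    qed
    show thesis
    proof (rule that[OF prime_X, of s])
      fix k assume "k \<in> S"
      then show "multiplicity [:0, 1:] (fibre k s) = (if k = k0 then 1 else 0)"
        using s assms(2)[of k] const[OF prime_X] prime_imp_prime_elem[OF prime_X[where 'a = rat]] None
        by (cases "(k, s)" rule: fibre.cases) auto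
    qed
  next
    case (Some tq)
    obtain t q where k0: "k0 = Some (t, q)" using Some by (cases tq) simp
    then have q: "prime q" "coeff q 0 \<noteq> 0" using assms(2)[OF assms(3)] by auto
    \<comment> \<open>Over \<open>t\<close>, the variable and the corners lying to the left of
      \<open>t\<close> have monomials as fibres. As \<open>q\<close> has a nonzero constant term, it
      is a prime different from \<open>[:0, 1:]\<close> and does not divide them.\<close>
    have mono: "multiplicity q (monom c n) = 0" if "c \<noteq> 0" for c n
    proof -
      have "q \<noteq> [:0, 1:]" using q(2) by auto
      then have "multiplicity q [:0, 1:] = 0"
        by (rule prime_multiplicity_other[OF q(1) prime_X])
      then have "multiplicity q ([:0, 1:] ^ n) = 0"
        using q(1) by (simp add: prime_elem_multiplicity_power_distrib)
      moreover have "monom c n = [:c:] * [:0, 1:] ^ n"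
        by (simp add: monom_altdef)
      ultimately show ?thesis
        using q(1) that const[OF q(1) that]
        by (simp add: prime_elem_multiplicity_mult_distrib del: mult_pCons_left)
    qed
    show thesis
    proof (rule that[OF q(1), of t])
      fix k assume "k \<in> S"
      show "multiplicity q (fibre k t) = (if k = k0 then 1 else 0)"
      proof (cases k)
        case None
        with mono[of 1 1] k0 show ?thesis by (simp add: monom_altdef)
      next
        case (Some t'p)
        obtain t' p where k: "k = Some (t', p)" using Some by (cases t'p) simp
        then have p: "prime p" "coeff p 0 \<noteq> 0" using assms(2)[OF \<open>k \<in> S\<close>] by auto
        then have "p \<noteq> 0" by auto
        with k k0 p q const[OF q(1)] mono show ?thesis
          by (auto simp: prime_multiplicity_other multiplicity_prime)
      qed
    qed
  qed
qed

text \<open>For any index \<open>k0\<close> occurring in \<open>K\<close> or \<open>L\<close>, the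
  multiplicity of its detecting prime in the fibres of the two products is \<open>count K k0\<close>
  and \<open>count L k0\<close>. The fibres agree up to constants, which are nonzero because
  \<open>layer c\<close> is.\<close>

lemma basic_factorization_unique:
  assumes "\<And>k. k \<in># K \<Longrightarrow> basic_index k" "\<And>k. k \<in># L \<Longrightarrow> basic_index k" "layer c \<noteq> 0"
    and eq: "(\<lambda>_. c) * prod_mset (image_mset basic K) = (\<lambda>_. d) * prod_mset (image_mset basic L)"
  shows "K = L"
proof (rule multiset_eqI, rule ccontr)
  fix k0 assume neq: "count K k0 \<noteq> count L k0"
  define S where "S = set_mset (K + L)"
  have S: "finite S" "\<And>k. k \<in> S \<Longrightarrow> basic_index k" using assms by (auto simp: S_def)
  have "k0 \<in> S" using neq by (auto simp: S_def not_in_iff)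
  from prime_detecting_index[OF S this] obtain p s where p: "prime p"
    and mult: "\<And>k. k \<in> S \<Longrightarrow> multiplicity p (fibre k s) = (if k = k0 then 1 else 0)" by blast
  define P where "P M = prod_mset (image_mset (\<lambda>k. fibre k s) M)" for M
  have ne: "0 \<notin># image_mset (\<lambda>k. fibre k s) M" if "set_mset M \<subseteq> S" for M
    using that S(2) fibre_nonzero by fastforce
  have P: "P M \<noteq> 0" "multiplicity p (P M) = count M k0" if "set_mset M \<subseteq> S" for M
  proof -
    show "P M \<noteq> 0" using ne[OF that] by (auto simp: P_def)
    have "multiplicity p (P M) = (\<Sum>k\<in>#M. multiplicity p (fibre k s))"
      unfolding P_def using p ne[OF that]
      by (simp add: prime_elem_multiplicity_prod_mset_distrib multiset.map_comp o_def)
    also have "\<dots> = (\<Sum>k\<in>#M. if k = k0 then 1 else 0)"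
      using that mult by (intro arg_cong[of _ _ sum_mset] image_mset_cong) auto
    finally show "multiplicity p (P M) = count M k0"
      by (simp add: sum_mset_delta)
  qed
  have KL: "set_mset K \<subseteq> S" "set_mset L \<subseteq> S" by (auto simp: S_def)
  have "poly (smult (layer c) (P K)) l = poly (smult (layer d) (P L)) l" for l
    using fun_cong[OF eq, of "ELT l s"] by (auto simp: P_def simp flip: layer_prod_basic dest: arg_cong[of _ _ layer])
  then have Peq: "smult (layer c) (P K) = smult (layer d) (P L)"
    unfolding poly_eq_poly_eq_iff[symmetric] by (rule ext)
  \<comment> \<open>The left side of \<open>Peq\<close> is nonzero, hence so is
    \<open>layer d\<close>; both scalars are then units and do not change multiplicities.\<close>
  have "layer d \<noteq> 0" using Peq assms(3) P(1)[OF KL(1)] by auto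
  have unit: "multiplicity p (smult u r) = multiplicity p r" if "u \<noteq> 0" for u r
    using that multiplicity_times_unit_right[of "[:u:]" p r]
    by (simp add: is_unit_const_poly_iff dvd_field_iff)
  have "multiplicity p (P K) = multiplicity p (P L)"
    using Peq unit assms(3) \<open>layer d \<noteq> 0\<close> by metis
  with neq P(2) KL show False by simp
qed

section \<open>Irreducible nondegenerate polynomials\<close>

lemma nondegenerate_basic:
  assumes "basic_index k"
  shows "nondegenerate (basic k)"
  unfolding nondegenerate_def
proof
  fix s
  have "poly (fibre k s) \<noteq> poly 0"
    using fibre_nonzero[OF assms] by (simp only: poly_eq_poly_eq_iff) simp
  then show "\<exists>l. layer (basic k (ELT l s)) \<noteq> 0"
    by (auto simp: layer_basic fun_eq_iff)
qed

text \<open>Two nonconstant factors would both expand into nonempty products of basic functions, and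
  uniqueness would make \<open>{#k#}\<close> a sum of two nonempty multisets.\<close>

lemma elt_irreducible_basic:
  assumes "basic_index k"
  shows "elt_irreducible (basic k)"
  unfolding elt_irreducible_def
proof (intro conjI notI)
  show "elt_poly (basic k)" by (rule elt_poly_basic)
  show False if "const_fun (basic k)" using that basic_not_const[OF assms] by blast
  assume "\<exists>g h. elt_poly g \<and> elt_poly h \<and> \<not> const_fun g \<and> \<not> const_fun h \<and> basic k = g * h"
  then obtain g h where gh: "elt_poly g" "elt_poly h" "\<not> const_fun g" "\<not> const_fun h"
    and eq: "basic k = g * h" by blast
  have nd: "nondegenerate g" "nondegenerate h"
    using nondegenerate_multD[of g h] nondegenerate_basic[OF assms] by (simp_all add: eq)
  obtain c K where K: "\<And>k. k \<in># K \<Longrightarrow> basic_index k"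
    "g = (\<lambda>_. c) * prod_mset (image_mset basic K)"
    using nondegenerate_factorization[OF gh(1) nd(1)] by metis
  obtain d L where L: "\<And>k. k \<in># L \<Longrightarrow> basic_index k"
    "h = (\<lambda>_. d) * prod_mset (image_mset basic L)"
    using nondegenerate_factorization[OF gh(2) nd(2)] by metis
  have "K \<noteq> {#}" "L \<noteq> {#}"
    using gh(3,4) K(2) L(2) by (auto simp: const_fun_def fun_eq_iff)
  have "(\<lambda>_. 1) * prod_mset (image_mset basic {#k#}) =
      (\<lambda>_. c * d) * prod_mset (image_mset basic (K + L))"
    using eq by (simp add: K(2) L(2) fun_eq_iff ac_simps)
  then have "{#k#} = K + L"
    using assms K(1) L(1) by (intro basic_factorization_unique) auto
  with \<open>K \<noteq> {#}\<close> \<open>L \<noteq> {#}\<close> show False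
    by (auto simp: single_is_union)
qed

text \<open>Take one basic factor \<open>basic k\<close> out of \<open>g\<close>. It is not
  constant, so irreducibility makes the remaining factor \<open>h\<close> constant.\<close>

lemma irreducible_eq_const_mult_basic:
  assumes "elt_irreducible g" "nondegenerate g"
  obtains k c where "basic_index k" "g = (\<lambda>_. c) * basic k"
proof -
  have g: "elt_poly g" "\<not> const_fun g"
    and irr: "\<And>u v. elt_poly u \<Longrightarrow> elt_poly v \<Longrightarrow> g = u * v \<Longrightarrow> const_fun u \<or> const_fun v"
    using assms(1) unfolding elt_irreducible_def by blast+
  obtain c K where K: "\<And>k. k \<in># K \<Longrightarrow> basic_index k"
    "g = (\<lambda>_. c) * prod_mset (image_mset basic K)"
    using nondegenerate_factorization[OF g(1) assms(2)] by metis
  have "K \<noteq> {#}" using g(2) K(2) by (auto simp: const_fun_def fun_eq_iff)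
  then obtain k L where KL: "K = add_mset k L" using multiset_cases by blast
  define h where "h = (\<lambda>_. c) * prod_mset (image_mset basic L)"
  have "elt_poly h"
    unfolding h_def by (intro elt_poly_mult elt_poly_const elt_poly_prod_mset) (auto simp: elt_poly_basic)
  moreover have "g = basic k * h" by (simp add: K(2) KL h_def ac_simps)
  ultimately have "const_fun h"
    using irr elt_poly_basic basic_not_const K(1) KL by (metis union_single_eq_member)
  then obtain d where "h = (\<lambda>_. d)" unfolding const_fun_def by blast
  then have "g = (\<lambda>_. d) * basic k" using \<open>g = basic k * h\<close> by (simp add: mult.commute)
  with K(1) KL show thesis by (intro that[of k]) simp_all
qed

text \<open>Each factor is replaced by its basic normal form and the constants are collected in
  \<open>c\<close>, which makes an arbitrary factorization comparable with one into basic
  functions.\<close>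

lemma irreducible_mset_eq_basic:
  assumes "\<And>g. g \<in># gs \<Longrightarrow> elt_irreducible g" "\<And>g. g \<in># gs \<Longrightarrow> nondegenerate g"
  shows "\<exists>c K. (\<forall>k\<in>#K. basic_index k) \<and> rel_mset eq_up_to_const gs (image_mset basic K) \<and>
    prod_mset gs = (\<lambda>_. c) * prod_mset (image_mset basic K)"
  using assms
proof (induction gs)
  case empty
  show ?case by (intro exI[of _ 1] exI[of _ "{#}"]) (simp add: one_fun_def fun_eq_iff)
next
  case (add g gs)
  have "elt_irreducible h" "nondegenerate h" if "h \<in># gs" for h
    using add.prems that by simp_all
  from add.IH[OF this] obtain c K where K: "\<forall>k\<in>#K. basic_index k"
    "rel_mset eq_up_to_const gs (image_mset basic K)"
    "prod_mset gs = (\<lambda>_. c) * prod_mset (image_mset basic K)"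
    by blast
  obtain k d where k: "basic_index k" "g = (\<lambda>_. d) * basic k"
    using irreducible_eq_const_mult_basic[of g] add.prems by auto
  have "eq_up_to_const g (basic k)" using k(2) unfolding eq_up_to_const_def by blast
  then have "rel_mset eq_up_to_const (add_mset g gs) (image_mset basic (add_mset k K))"
    using K(2) by (simp add: rel_mset_Plus)
  moreover have "prod_mset (add_mset g gs) = (\<lambda>_. d * c) * prod_mset (image_mset basic (add_mset k K))"
    by (simp add: K(3) k(2) fun_eq_iff ac_simps)
  ultimately show ?case using K(1) k(1) by (intro exI[of _ "d * c"] exI[of _ "add_mset k K"]) auto
qed

theorem theorem5p13:
  fixes f :: "(rat, real) elt \<Rightarrow> (rat, real) elt"
  assumes "elt_poly f" and "elt_regular f"
  shows "\<exists>fs. irreducible_factorization f fs \<and>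
           (\<forall>gs. irreducible_factorization f gs \<longrightarrow> rel_mset eq_up_to_const gs fs)"
proof -
  have nd: "nondegenerate f" using assms(2) by (rule elt_regular_imp_nondegenerate)
  obtain c K where K: "\<And>k. k \<in># K \<Longrightarrow> basic_index k"
    and f: "f = (\<lambda>_. c) * prod_mset (image_mset basic K)"
    using nondegenerate_factorization[OF assms(1) nd] by metis
  \<comment> \<open>A constant of layer 0 would make every fibre of \<open>f\<close> vanish.\<close>
  have c: "layer c \<noteq> 0" using nd by (auto simp: nondegenerate_def f)
  show ?thesis
  proof (intro exI conjI allI impI)
    show "irreducible_factorization f (image_mset basic K)"
      unfolding irreducible_factorization_def using K f by (auto intro: elt_irreducible_basic)
    fix gs assume "irreducible_factorization f gs"
    then obtain d where irr: "\<And>g. g \<in># gs \<Longrightarrow> elt_irreducible g" and f_gs: "f = (\<lambda>_. d) * prod_mset gs"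
      unfolding irreducible_factorization_def by blast
    \<comment> \<open>The factors in \<open>gs\<close> need not be regular by assumption, but they
      inherit nondegeneracy from \<open>f\<close>, so each is a constant times a basic
      function.\<close>
    have "nondegenerate (prod_mset gs)" using nondegenerate_multD(2) nd f_gs by blast
    then obtain e L where L: "\<And>k. k \<in># L \<Longrightarrow> basic_index k"
      "rel_mset eq_up_to_const gs (image_mset basic L)"
      "prod_mset gs = (\<lambda>_. e) * prod_mset (image_mset basic L)"
      using irreducible_mset_eq_basic[of gs] irr nondegenerate_prod_msetD by blast
    have "(\<lambda>_. c) * prod_mset (image_mset basic K) = (\<lambda>_. d) * prod_mset gs"
      using f f_gs by (rule trans[OF sym])
    also have "\<dots> = (\<lambda>_. d * e) * prod_mset (image_mset basic L)"
      unfolding L(3) by (simp add: fun_eq_iff mult.assoc)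
    finally have "(\<lambda>_. c) * prod_mset (image_mset basic K) =
        (\<lambda>_. d * e) * prod_mset (image_mset basic L)" .
    then have "K = L" using basic_factorization_unique[OF K L(1) c] by blast
    with L(2) show "rel_mset eq_up_to_const gs (image_mset basic K)" by simp
  qed
qed

end
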